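(* Given $t\in(0,\infty)^m$, $f\in(0,1]^m$, $g\in(0,\infty)^m$, $H\in(0,\infty)$ and a tolerance $\varepsilon\in(0,1)$, the algorithm $\mathsf{F}$ described in the context produces, in $O(m^3/\varepsilon)$ time, a $(1-\varepsilon)$-optimal application portfolio for Ellis's problem $$\text{maximize } v(\mathcal{X})\quad\text{subject to }\mathcal{X}\subseteq\mathcal{C}=\{1,\dots,m\},\ \sum_{j\in\mathcal{X}}g_j\le H;$$ that is, a feasible portfolio whose valuation is at least $(1-\varepsilon)$ times the optimal value.
   Context: Let $Z_1,\dots,Z_m$ be independent Bernoulli random variables with $\Pr(Z_j=1)=f_j$, let $t_0=0$, and let $v(\mathcal{X})=\operatorname{E}\bigl[\max\{t_0,\max\{t_jZ_j:j\in\mathcal{X}\}\}\bigr]$, $v(\varnothing)=0$. It is assumed that $g_j\le H$ for each $j$ and $\sum_jg_j>H$. Running time counts arithmetic operations (including rounding down) and comparisons on numbers as unit time. Algorithm $\mathsf{F}$. (1) Index the schools so that $t_1\le\cdots\le t_m$. (2) Let $\bar U=\sum_{j\in\mathcal{C}}f_jt_j$ and set the precision $P=\bigl\lceil\log_{10}\bigl(m^2/(\varepsilon\bar U)\bigr)\bigr\rceil$. Let $r[x]=10^{-P}\lfloor10^Px\rfloor$ and let $\mathcal{V}=\{0,1\cdot10^{-P},2\cdot10^{-P},\dots,r[\bar U]\}$. (3) Fill a lookup table with the entries $G[j,v]$, for $0\le j\le m$ and $v\in\mathcal{V}$, where for $v\in[-\infty,0)\cup\mathcal{V}$: $G[j,v]=0$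 if $v\le0$; $G[0,v]=\infty$ if $v>0$; and for $j\ge1$, $v>0$, $$G[j,v]=\begin{cases}\infty,&t_j<v,\\ \min\bigl\{G[j-1,v],\ g_j+G[j-1,v-\Delta_j(v)]\bigr\},&t_j\ge v,\end{cases}\qquad \Delta_j(v)=\begin{cases}r\bigl[\tfrac{f_j}{1-f_j}(t_j-v)\bigr],&f_j<1,\\ \infty,&f_j=1.\end{cases}$$ (4) Set $v\gets\max\{w\in\mathcal{V}:G[m,w]\le H\}$ and $\mathcal{X}\gets\varnothing$. (5) For $j=m,m-1,\dots,1$: if $G[j,v]<\infty$ and $G[j,v]<G[j-1,v]$, set $\mathcal{X}\gets\mathcal{X}\cup\{j\}$ and $v\gets v-\Delta_j(v)$. (6) Return $\mathcal{X}$. *)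

theory Defs
  imports "HOL-Probability.Probability" "HOL-Library.Monad_Syntax"
begin

section \<open>Ellis's problem\<close>

text \<open>
  Schools are the indices \<open>1, \<dots>, m\<close>; the data of an instance are functions on \<open>nat\<close> of which
  only the values on \<open>{1..m}\<close> matter.  The random vector \<open>Z\<close> has independent components, with
  \<open>Z j\<close> being true with probability \<open>f j\<close>.
\<close>

definition admissions :: "nat \<Rightarrow> (nat \<Rightarrow> real) \<Rightarrow> (nat \<Rightarrow> bool) pmf" where
  "admissions m f = Pi_pmf {1..m} False (\<lambda>j. bernoulli_pmf (f j))"

text \<open>The inserted \<open>0\<close> is \<open>t\<^sub>0\<close>.\<close>

definition valuation ::
    "nat \<Rightarrow> (nat \<Rightarrow> real) \<Rightarrow> (nat \<Rightarrow> real) \<Rightarrow> nat set \<Rightarrow> real" where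
  "valuation m t f X =
     measure_pmf.expectation (admissions m f)
       (\<lambda>Z. Max (insert 0 ((\<lambda>j. t j * of_bool (Z j)) ` X)))"

definition feasible :: "nat \<Rightarrow> (nat \<Rightarrow> real) \<Rightarrow> real \<Rightarrow> nat set \<Rightarrow> bool" where
  "feasible m g H X \<longleftrightarrow> X \<subseteq> {1..m} \<and> (\<Sum>j\<in>X. g j) \<le> H"

definition optimal_value ::
    "nat \<Rightarrow> (nat \<Rightarrow> real) \<Rightarrow> (nat \<Rightarrow> real) \<Rightarrow> (nat \<Rightarrow> real) \<Rightarrow> real \<Rightarrow> real" where
  "optimal_value m t f g H = Max (valuation m t f ` {X. feasible m g H X})"

definition ellis_instance ::
    "nat \<Rightarrow> (nat \<Rightarrow> real) \<Rightarrow> (nat \<Rightarrow> real) \<Rightarrow> (nat \<Rightarrow> real) \<Rightarrow> real \<Rightarrow> bool" where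
  "ellis_instance m t f g H \<longleftrightarrow>
     (\<forall>j\<in>{1..m}. 0 < t j \<and> 0 < f j \<and> f j \<le> 1 \<and> 0 < g j \<and> g j \<le> H) \<and>
     0 < H \<and> H < (\<Sum>j\<in>{1..m}. g j)"


section \<open>Counting elementary operations\<close>

text \<open>
  A timed computation carries its result together with the number of elementary operations
  spent on it.  Programs below are written so that every argument of \<open>tick\<close> is exactly one
  elementary operation applied to values already computed: an arithmetic operation, rounding,
  a comparison (or binary minimum or maximum) of numbers, or adding one element to a list or to
  the portfolio.  Arithmetic is exact, and extended reals and loop indices count as numbers.
  Embeddings of one number type into another are free.  Array accesses and loop control are
  charged as well.
\<close>

datatype 'a timed = Timed (result: 'a) (time: nat)

definition ret :: "'a \<Rightarrow> 'a timed" where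
  "ret x = Timed x 0"

definition tick :: "'a \<Rightarrow> 'a timed" where
  "tick x = Timed x 1"

definition bind_timed :: "'a timed \<Rightarrow> ('a \<Rightarrow> 'b timed) \<Rightarrow> 'b timed" where
  "bind_timed c k = Timed (result (k (result c))) (time c + time (k (result c)))"

adhoc_overloading Monad_Syntax.bind \<rightleftharpoons> bind_timed

text \<open>
  Arrays are threaded linearly through the programs, so that an update can be performed in place.
  They start out as \<open>undefined\<close>.
\<close>

definition get :: "('i \<Rightarrow> 'a) \<Rightarrow> 'i \<Rightarrow> 'a timed" where
  "get a i = tick (a i)"

definition put :: "('i \<Rightarrow> 'a) \<Rightarrow> 'i \<Rightarrow> 'a \<Rightarrow> ('i \<Rightarrow> 'a) timed" where
  "put a i x = tick (a(i := x))"

text \<open>One unit for each test for the end of the loop, and one for advancing to the next index.\<close>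

primrec for_each :: "'i list \<Rightarrow> ('i \<Rightarrow> 's \<Rightarrow> 's timed) \<Rightarrow> 's \<Rightarrow> 's timed" where
  "for_each [] body s = tick s"
| "for_each (i # is) body s = do {
     _ \<leftarrow> Timed () 2;
     s \<leftarrow> body i s;
     for_each is body s
   }"


section \<open>The approximation algorithm\<close>

subsection \<open>Sorting the schools\<close>

primrec insort_timed :: "(nat \<Rightarrow> real) \<Rightarrow> nat \<Rightarrow> nat list \<Rightarrow> nat list timed" where
  "insort_timed t i [] = tick [i]"
| "insort_timed t i (k # ks) = do {
     ti \<leftarrow> get t i;
     tk \<leftarrow> get t k;
     b \<leftarrow> tick (ti \<le> tk);
     if b then tick (i # k # ks)
     else do { ks \<leftarrow> insort_timed t i ks; tick (k # ks) }
   }"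

text \<open>
  The \<open>j\<close>-th school in the new order is school \<open>p j\<close> of the input; \<open>ts\<close>, \<open>fs\<close>, \<open>gs\<close> are the data
  in the new order.
\<close>

definition sort_schools ::
    "nat \<Rightarrow> (nat \<Rightarrow> real) \<Rightarrow> (nat \<Rightarrow> real) \<Rightarrow> (nat \<Rightarrow> real) \<Rightarrow>
     ((nat \<Rightarrow> nat) \<times> (nat \<Rightarrow> real) \<times> (nat \<Rightarrow> real) \<times> (nat \<Rightarrow> real)) timed" where
  "sort_schools m t f g = do {
     order \<leftarrow> for_each [1..<m + 1] (insort_timed t) [];
     for_each (zip [1..<m + 1] order)
       (\<lambda>(j, i) (p, ts, fs, gs). do {
          p \<leftarrow> put p j i;
          x \<leftarrow> get t i;
          ts \<leftarrow> put ts j x;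
          x \<leftarrow> get f i;
          fs \<leftarrow> put fs j x;
          x \<leftarrow> get g i;
          gs \<leftarrow> put gs j x;
          ret (p, ts, fs, gs)
        })
       ((\<lambda>_. undefined), (\<lambda>_. undefined), (\<lambda>_. undefined), (\<lambda>_. undefined))
   }"

subsection \<open>Precision\<close>

definition total_utility :: "nat \<Rightarrow> (nat \<Rightarrow> real) \<Rightarrow> (nat \<Rightarrow> real) \<Rightarrow> real timed" where
  "total_utility m t f =
     for_each [1..<m + 1]
       (\<lambda>j u. do {
          fj \<leftarrow> get f j;
          tj \<leftarrow> get t j;
          x \<leftarrow> tick (fj * tj);
          tick (u + x)
        }) 0"

text \<open>
  The result is \<open>S = 10\<^bsup>P\<^esup>\<close>.  The logarithm and the power \<open>10\<^bsup>P\<^esup>\<close>, each evaluated just once, count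
  as one operation: computing them by repeated multiplication would take a number of steps that
  is not bounded in terms of \<open>m\<close> and \<open>\<epsilon>\<close>.  Note that \<open>P\<close> may be negative.
\<close>

definition precision_scale :: "nat \<Rightarrow> real \<Rightarrow> real \<Rightarrow> real timed" where
  "precision_scale m \<epsilon> U = do {
     a \<leftarrow> tick (real m * real m);
     b \<leftarrow> tick (\<epsilon> * U);
     c \<leftarrow> tick (a / b);
     d \<leftarrow> tick (log 10 c);
     P \<leftarrow> tick \<lceil>d\<rceil>;
     tick (10 powi P)
   }"

text \<open>In what follows \<open>S = 10\<^bsup>P\<^esup>\<close> and \<open>\<delta> = 10\<^bsup>-P\<^esup>\<close>.\<close>

definition round_down :: "real \<Rightarrow> real \<Rightarrow> real \<Rightarrow> real timed" where
  "round_down S \<delta> x = do {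
     y \<leftarrow> tick (S * x);
     z \<leftarrow> tick \<lfloor>y\<rfloor>;
     tick (\<delta> * of_int z)
   }"

text \<open>The set \<open>\<V>\<close> consists of the numbers \<open>k \<cdot> 10\<^bsup>-P\<^esup>\<close> with \<open>k \<le> grid_size\<close>.\<close>

definition grid_size :: "real \<Rightarrow> real \<Rightarrow> nat timed" where
  "grid_size S U = do {
     y \<leftarrow> tick (S * U);
     z \<leftarrow> tick \<lfloor>y\<rfloor>;
     ret (nat z)
   }"

subsection \<open>The lookup table\<close>

text \<open>
  The cell \<open>(j, k)\<close> of the table holds \<open>G[j, v]\<close> for \<open>v = k \<cdot> 10\<^bsup>-P\<^esup>\<close>.  Values \<open>v \<le> 0\<close>, in particular
  negative ones and \<open>-\<infinity>\<close>, are answered without consulting the table.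
\<close>

definition lookup ::
    "real \<Rightarrow> (nat \<times> nat \<Rightarrow> ereal) \<Rightarrow> nat \<Rightarrow> ereal \<Rightarrow> ereal timed" where
  "lookup S G j v = do {
     b \<leftarrow> tick (v \<le> 0);
     if b then ret 0
     else do {
       y \<leftarrow> tick (S * real_of_ereal v);
       k \<leftarrow> tick \<lfloor>y\<rfloor>;
       get G (j, nat k)
     }
   }"

text \<open>\<open>shifted S \<delta> fj tj v\<close> is \<open>v - \<Delta>\<^sub>j(v)\<close>; it is only ever evaluated at positive reals \<open>v\<close>.\<close>

definition shifted :: "real \<Rightarrow> real \<Rightarrow> real \<Rightarrow> real \<Rightarrow> ereal \<Rightarrow> ereal timed" where
  "shifted S \<delta> fj tj v = do {
     b \<leftarrow> tick (fj < 1);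
     \<Delta> \<leftarrow>
       (if b then do {
          a \<leftarrow> tick (1 - fj);
          q \<leftarrow> tick (fj / a);
          x \<leftarrow> tick (tj - real_of_ereal v);
          y \<leftarrow> tick (q * x);
          d \<leftarrow> round_down S \<delta> y;
          ret (ereal d)
        }
        else ret \<infinity>);
     tick (v - \<Delta>)
   }"

definition entry ::
    "(nat \<Rightarrow> real) \<Rightarrow> (nat \<Rightarrow> real) \<Rightarrow> (nat \<Rightarrow> real) \<Rightarrow> real \<Rightarrow> real \<Rightarrow>
     (nat \<times> nat \<Rightarrow> ereal) \<Rightarrow> nat \<Rightarrow> real \<Rightarrow> ereal timed" where
  "entry t f g S \<delta> G j v = do {
     b \<leftarrow> tick (v \<le> 0);
     if b then ret 0
     else do {
       b \<leftarrow> tick (j = 0);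
       if b then ret \<infinity>
       else do {
         tj \<leftarrow> get t j;
         b \<leftarrow> tick (tj < v);
         if b then ret \<infinity>
         else do {
           fj \<leftarrow> get f j;
           gj \<leftarrow> get g j;
           i \<leftarrow> tick (j - 1);
           x \<leftarrow> lookup S G i (ereal v);
           w \<leftarrow> shifted S \<delta> fj tj (ereal v);
           y \<leftarrow> lookup S G i w;
           z \<leftarrow> tick (ereal gj + y);
           tick (min x z)
         }
       }
     }
   }"

definition fill_table ::
    "nat \<Rightarrow> (nat \<Rightarrow> real) \<Rightarrow> (nat \<Rightarrow> real) \<Rightarrow> (nat \<Rightarrow> real) \<Rightarrow> real \<Rightarrow> real \<Rightarrow> nat \<Rightarrow>
     (nat \<times> nat \<Rightarrow> ereal) timed" where
  "fill_table m t f g S \<delta> N =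
     for_each [0..<m + 1]
       (\<lambda>j. for_each [0..<N + 1]
          (\<lambda>k G. do {
             v \<leftarrow> tick (real k * \<delta>);
             x \<leftarrow> entry t f g S \<delta> G j v;
             put G (j, k) x
           }))
       (\<lambda>_. undefined)"

subsection \<open>Reading off a portfolio\<close>

text \<open>The initial value \<open>0\<close> of the maximum is legitimate since \<open>0 \<in> \<V>\<close> and \<open>G[m, 0] = 0 \<le> H\<close>.\<close>

definition best_value ::
    "nat \<Rightarrow> real \<Rightarrow> real \<Rightarrow> real \<Rightarrow> nat \<Rightarrow> (nat \<times> nat \<Rightarrow> ereal) \<Rightarrow> real timed" where
  "best_value m H S \<delta> N G =
     for_each [0..<N + 1]
       (\<lambda>k best. do {
          w \<leftarrow> tick (real k * \<delta>);
          x \<leftarrow> lookup S G m (ereal w);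
          b \<leftarrow> tick (x \<le> ereal H);
          if b then tick (max best w) else ret best
        }) 0"

definition backtrack ::
    "nat \<Rightarrow> (nat \<Rightarrow> nat) \<Rightarrow> (nat \<Rightarrow> real) \<Rightarrow> (nat \<Rightarrow> real) \<Rightarrow> real \<Rightarrow> real \<Rightarrow>
     (nat \<times> nat \<Rightarrow> ereal) \<Rightarrow> real \<Rightarrow> nat set timed" where
  "backtrack m p t f S \<delta> G v\<^sub>0 = do {
     (X, v) \<leftarrow> for_each (rev [1..<m + 1])
       (\<lambda>j (X, v). do {
          x \<leftarrow> lookup S G j v;
          b \<leftarrow> tick (x < \<infinity>);
          if b then do {
            i \<leftarrow> tick (j - 1);
            y \<leftarrow> lookup S G i v;
            c \<leftarrow> tick (x < y);
            if c then do {
              s \<leftarrow> get p j;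
              X \<leftarrow> tick (insert s X);
              fj \<leftarrow> get f j;
              tj \<leftarrow> get t j;
              v \<leftarrow> shifted S \<delta> fj tj v;
              ret (X, v)
            }
            else ret (X, v)
          }
          else ret (X, v)
        }) ({}, ereal v\<^sub>0);
     ret X
   }"

subsection \<open>The algorithm\<close>

definition algorithm_F ::
    "nat \<Rightarrow> (nat \<Rightarrow> real) \<Rightarrow> (nat \<Rightarrow> real) \<Rightarrow> (nat \<Rightarrow> real) \<Rightarrow> real \<Rightarrow> real \<Rightarrow> nat set timed" where
  "algorithm_F m t f g H \<epsilon> = do {
     (p, ts, fs, gs) \<leftarrow> sort_schools m t f g;
     U \<leftarrow> total_utility m ts fs;
     S \<leftarrow> precision_scale m \<epsilon> U;
     \<delta> \<leftarrow> tick (1 / S);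
     N \<leftarrow> grid_size S U;
     G \<leftarrow> fill_table m ts fs gs S \<delta> N;
     v \<leftarrow> best_value m H S \<delta> N G;
     backtrack m p ts fs S \<delta> G v
   }"

end

theory Submission
  imports Defs
begin

text \<open>
  If \<open>j\<close> has the largest utility in \<open>{j} \<union> Y\<close>, then conditioning on \<open>Z\<^sub>j\<close> gives
  \<open>v({j} \<union> Y) = f\<^sub>j t\<^sub>j + (1 - f\<^sub>j) v(Y)\<close>, so valuation \<open>w\<close> for \<open>{j} \<union> Y\<close> amounts to valuation
  \<open>w - \<Delta>\<^sub>j(w)\<close> for \<open>Y\<close>, with \<open>\<Delta>\<close> unrounded.  Rounding \<open>\<Delta>\<close> down only raises the target, hence the
  portfolio read off the table has at least the valuation it promises; and each selected school
  raises the target by at most \<open>10\<^bsup>-P\<^esup>\<close>.  An optimal portfolio omits some school, so its value is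
  attained up to \<open>m 10\<^bsup>-P\<^esup>\<close>, one unit being lost by rounding to the grid.  This is at most
  \<open>\<epsilon> U / m\<close> where \<open>U = \<Sum>\<^sub>j f\<^sub>j t\<^sub>j\<close>, and since every single school is affordable, \<open>U / m\<close> is at most the
  optimum.
\<close>

section \<open>The valuation of a portfolio\<close>

lemma valuation_empty: "valuation m t f {} = 0"
  by (simp add: valuation_def)

lemma expectation_Pi_pmf_bernoulli_split:
  fixes h :: "('a \<Rightarrow> bool) \<Rightarrow> real"
  assumes A: "finite A" "i \<in> A" and f: "0 \<le> f i" "f i \<le> 1"
  shows "measure_pmf.expectation (Pi_pmf A False (\<lambda>j. bernoulli_pmf (f j))) h =
    f i * measure_pmf.expectation (Pi_pmf (A - {i}) False (\<lambda>j. bernoulli_pmf (f j)))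
      (\<lambda>Z. h (Z(i := True))) +
    (1 - f i) * measure_pmf.expectation (Pi_pmf (A - {i}) False (\<lambda>j. bernoulli_pmf (f j)))
      (\<lambda>Z. h (Z(i := False)))"
proof -
  let ?Q = "Pi_pmf (A - {i}) False (\<lambda>j. bernoulli_pmf (f j))"
  have fin: "finite (set_pmf ?Q)"
    using A by (simp add: set_Pi_pmf finite_PiE_dflt)
  have "Pi_pmf A False (\<lambda>j. bernoulli_pmf (f j)) =
      bernoulli_pmf (f i) \<bind> (\<lambda>y. map_pmf (\<lambda>Z. Z(i := y)) ?Q)"
    using Pi_pmf_insert'[of "A - {i}" i False "\<lambda>j. bernoulli_pmf (f j)"] A
    by (simp add: insert_absorb map_pmf_def)
  also have "measure_pmf.expectation \<dots> h =
      (\<Sum>y\<in>UNIV. pmf (bernoulli_pmf (f i)) y *\<^sub>R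
        measure_pmf.expectation (map_pmf (\<lambda>Z. Z(i := y)) ?Q) h)"
    by (rule pmf_expectation_bind) (use fin in auto)
  finally show ?thesis
    using f by (simp add: UNIV_bool fun_upd_def)
qed

lemma Max_insert_top:
  fixes t :: "'a \<Rightarrow> real"
  assumes "finite X" "0 \<le> t i" "\<And>k. k \<in> X \<Longrightarrow> t k \<le> t i" "\<And>k. k \<in> X \<Longrightarrow> 0 \<le> t k"
  shows "Max (insert 0 ((\<lambda>j. t j * of_bool (Z j)) ` insert i X)) =
    (if Z i then t i else Max (insert 0 ((\<lambda>j. t j * of_bool (Z j)) ` X)))"
proof (cases "Z i")
  case True
  have "Max (insert 0 ((\<lambda>j. t j * of_bool (Z j)) ` insert i X)) = t i"
    using assms True by (intro Max_eqI) auto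
  with True show ?thesis by simp
next
  case False
  then show ?thesis by simp
qed

lemma valuation_insert_top:
  assumes X: "X \<subseteq> {1..m}" and i: "i \<in> {1..m}" "i \<notin> X" and f: "0 \<le> f i" "f i \<le> 1"
    and t: "0 \<le> t i" "\<And>k. k \<in> X \<Longrightarrow> t k \<le> t i" "\<And>k. k \<in> X \<Longrightarrow> 0 \<le> t k"
  shows "valuation m t f (insert i X) = f i * t i + (1 - f i) * valuation m t f X"
proof -
  let ?M = "\<lambda>X Z. Max (insert 0 ((\<lambda>j. t j * of_bool (Z j)) ` X))"
  let ?Q = "Pi_pmf ({1..m} - {i}) False (\<lambda>j. bernoulli_pmf (f j))"
  have finX: "finite X" using X finite_subset by blast
  have upd: "?M X (Z(i := b)) = ?M X Z" for Z b
  proof -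
    have "(\<lambda>j. t j * of_bool ((Z(i := b)) j)) ` X = (\<lambda>j. t j * of_bool (Z j)) ` X"
      using i(2) by (intro image_cong) auto
    then show ?thesis by presburger
  qed
  have top: "?M (insert i X) (Z(i := b)) = (if b then t i else ?M X Z)" for Z b
    by (simp only: Max_insert_top[where t = t, OF finX t] upd fun_upd_same)
  have "valuation m t f X = measure_pmf.expectation ?Q (?M X)"
    unfolding valuation_def admissions_def
    by (subst expectation_Pi_pmf_bernoulli_split[where i = i])
       (use i(1) f in \<open>simp_all only: upd finite_atLeastAtMost, auto simp: algebra_simps\<close>)
  moreover have "valuation m t f (insert i X) =
      f i * t i + (1 - f i) * measure_pmf.expectation ?Q (?M X)"
    unfolding valuation_def admissions_def
    by (subst expectation_Pi_pmf_bernoulli_split[where i = i])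
       (use i(1) f in \<open>simp_all only: top finite_atLeastAtMost if_True if_False, auto\<close>)
  ultimately show ?thesis by simp
qed


section \<open>Timed programs\<close>

lemma timed_simps [simp]:
  "result (ret x) = x" "time (ret x) = 0"
  "result (tick x) = x" "time (tick x) = 1"
  "result (bind_timed c k) = result (k (result c))"
  "time (bind_timed c k) = time c + time (k (result c))"
  "result (get a i) = a i" "time (get a i) = 1"
  "result (put a i x) = a(i := x)" "time (put a i x) = 1"
  by (simp_all add: ret_def tick_def bind_timed_def get_def put_def)

lemma result_for_each: "result (for_each is body s) = fold (\<lambda>i s. result (body i s)) is s"
  by (induction "is" arbitrary: s) simp_all

lemma result_for_each_upt:
  assumes "a \<le> b" "I a s"
    and "\<And>i s. a \<le> i \<Longrightarrow> i < b \<Longrightarrow> I i s \<Longrightarrow> I (Suc i) (result (body i s))"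
  shows "I b (result (for_each [a..<b] body s))"
  using assms by (induction b rule: dec_induct) (simp_all add: result_for_each)

lemma time_for_each:
  assumes "\<And>i s. i \<in> set is \<Longrightarrow> time (body i s) \<le> c"
  shows "time (for_each is body s) \<le> length is * (c + 2) + 1"
  using assms
proof (induction "is" arbitrary: s)
  case (Cons i "is")
  have "time (body i s) \<le> c" by (rule Cons.prems) simp
  moreover have "time (for_each is body (result (body i s))) \<le> length is * (c + 2) + 1"
    by (rule Cons.IH) (use Cons.prems in auto)
  ultimately show ?case by simp
qed simp

lemma time_round_down: "time (round_down S \<delta> x) = 3"
  by (simp add: round_down_def)

lemma time_lookup: "time (lookup S G j v) \<le> 4"
  by (simp add: lookup_def)

lemma time_shifted: "time (shifted S \<delta> a b v) \<le> 9"
  by (simp add: shifted_def time_round_down)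

lemma time_entry: "time (entry t f g S \<delta> G j v) \<le> 30"
  using time_lookup[of S G "j - 1" "ereal v"] time_shifted[of S \<delta> "f j" "t j" "ereal v"]
    time_lookup[of S G "j - 1" "result (shifted S \<delta> (f j) (t j) (ereal v))"]
  by (simp add: entry_def)

lemma time_fill_table: "time (fill_table m t f g S \<delta> N) \<le> (m + 1) * ((N + 1) * 34 + 3) + 1"
proof -
  have body: "time (for_each [0..<N + 1] (\<lambda>k G. bind_timed (tick (real k * \<delta>))
      (\<lambda>v. bind_timed (entry t f g S \<delta> G j v) (\<lambda>x. put G (j, k) x))) G) \<le> (N + 1) * 34 + 1" for j G
  proof (rule order.trans[OF time_for_each[where c = 32]])
    show "time (bind_timed (tick (real k * \<delta>))
      (\<lambda>v. bind_timed (entry t f g S \<delta> G j v) (\<lambda>x. put G (j, k) x))) \<le> 32" for k G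
      using time_entry[of t f g S \<delta> G j "real k * \<delta>"] by simp
  qed simp
  show ?thesis
    unfolding fill_table_def
    by (rule order.trans[OF time_for_each[where c = "(N + 1) * 34 + 1"]]) (use body in auto)
qed

lemma time_best_value: "time (best_value m H S \<delta> N G) \<le> (N + 1) * 9 + 1"
  unfolding best_value_def
proof (rule order.trans[OF time_for_each[where c = 7]])
  fix k best
  show "time (bind_timed (tick (real k * \<delta>)) (\<lambda>w. bind_timed (lookup S G m (ereal w))
      (\<lambda>x. bind_timed (tick (x \<le> ereal H)) (\<lambda>b. if b then tick (max best w) else ret best)))) \<le> 7"
    using time_lookup[of S G m "ereal (real k * \<delta>)"] by simp
qed simp

lemma time_backtrack: "time (backtrack m p t f S \<delta> G v) \<le> m * 26 + 1"
proof -
  have loop: "time (for_each (rev [1..<m + 1]) body s) + 0 \<le> m * 26 + 1"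
    if "\<And>i s. time (body i s) \<le> 24" for body :: "nat \<Rightarrow> nat set \<times> ereal \<Rightarrow> _" and s
    using time_for_each[of "rev [1..<m + 1]" body 24 s] that by (simp del: upt_Suc)
  show ?thesis
    unfolding backtrack_def timed_simps split_def
  proof (rule loop, goal_cases)
    case (1 j s)
    show ?case
      using time_lookup[of S G j "snd s"] time_lookup[of S G "j - 1" "snd s"]
        time_shifted[of S \<delta> "f j" "t j" "snd s"]
      by simp
  qed
qed

lemma result_insort_timed: "result (insort_timed t i ks) = insort_key t i ks"
  by (induction ks) simp_all

lemma time_insort_timed: "time (insort_timed t i ks) \<le> 4 * length ks + 1"
  by (induction ks) simp_all

lemma time_insertion_sort:
  "time (for_each is (insort_timed t) ks) \<le> length is * (4 * (length is + length ks) + 3) + 1"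
proof (induction "is" arbitrary: ks)
  case (Cons i "is")
  have "time (for_each is (insort_timed t) (insort_key t i ks))
      \<le> length is * (4 * (length is + Suc (length ks)) + 3) + 1"
    using Cons.IH[of "insort_key t i ks"] by simp
  moreover have "time (insort_timed t i ks) \<le> 4 * length ks + 1"
    by (rule time_insort_timed)
  ultimately show ?case
    by (simp add: result_insort_timed algebra_simps)
qed simp

lemma result_insertion_sort:
  "result (for_each is (insort_timed t) []) = sort_key t (rev is)"
  by (simp add: result_for_each result_insort_timed sort_key_def foldr_conv_fold)

lemma time_sort_schools: "time (sort_schools m t f g) \<le> m * (4 * m + 12) + 2"
proof -
  let ?order = "sort_key t (rev [1..<m + 1])"
  have "time (for_each (zip [1..<m + 1] ?order) body s) \<le> m * (7 + 2) + 1"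
    if "\<And>i s. time (body i s) \<le> 7"
    for s and body :: "_ \<Rightarrow> (nat \<Rightarrow> nat) \<times> (nat \<Rightarrow> real) \<times> (nat \<Rightarrow> real) \<times> (nat \<Rightarrow> real) \<Rightarrow> _"
    using time_for_each[of "zip [1..<m + 1] ?order" body 7 s] that
    by (simp del: upt_Suc)
  note loop = this
  have "time (sort_schools m t f g) \<le> (m * (4 * m + 3) + 1) + (m * (7 + 2) + 1)"
    unfolding sort_schools_def timed_simps(6) result_insertion_sort
    by (intro add_mono loop order.trans[OF time_insertion_sort]) (auto simp: split_def)
  then show ?thesis
    by (simp add: algebra_simps)
qed

lemma time_total_utility: "time (total_utility m t f) \<le> m * 6 + 1"
  unfolding total_utility_def by (rule order.trans[OF time_for_each[where c = 4]]) simp_all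

lemma result_total_utility: "result (total_utility m t f) = (\<Sum>j\<in>{1..m}. f j * t j)"
proof -
  have "result (total_utility m t f) = (\<Sum>j\<in>{1..<m + 1}. f j * t j)"
    unfolding total_utility_def
    by (rule result_for_each_upt[where I = "\<lambda>i u. u = (\<Sum>j\<in>{1..<i}. f j * t j)"]) simp_all
  then show ?thesis
    by (simp add: atLeastLessThanSuc_atLeastAtMost)
qed

lemma result_sort_schools:
  fixes t f g :: "nat \<Rightarrow> real"
  obtains p ts fs gs where "result (sort_schools m t f g) = (p, ts, fs, gs)"
    "bij_betw p {1..m} {1..m}"
    "\<forall>j\<in>{1..m}. ts j = t (p j) \<and> fs j = f (p j) \<and> gs j = g (p j)"
    "mono_on {1..m} ts"
proof -
  let ?order = "sort_key t (rev [1..<m + 1])"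
  let ?body = "\<lambda>(j, i) (p, ts, fs, gs).
     bind_timed (put p j i) (\<lambda>p. bind_timed (get t i) (\<lambda>x. bind_timed (put ts j x)
     (\<lambda>ts. bind_timed (get f i) (\<lambda>x. bind_timed (put fs j x)
     (\<lambda>fs. bind_timed (get g i) (\<lambda>x. bind_timed (put gs j x) (\<lambda>gs. ret (p, ts, fs, gs))))))))"
  have len: "length ?order = m" by simp
  define R where "R = (\<lambda>n (p, ts, fs, gs).
     (\<forall>j. 1 \<le> j \<and> j \<le> n \<longrightarrow> p j = ?order ! (j - 1) \<and> ts j = t (p j) \<and> fs j = f (p j) \<and> gs j = g (p j)))"
  have "R n (result (for_each (take n (zip [1..<m + 1] ?order)) ?body s))" if "n \<le> m" for n s
    using that
  proof (induction n)
    case 0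
    then show ?case by (auto simp: R_def)
  next
    case (Suc n)
    have "take (Suc n) (zip [1..<m + 1] ?order) =
        take n (zip [1..<m + 1] ?order) @ [(Suc n, ?order ! n)]"
      using Suc.prems len by (subst take_Suc_conv_app_nth) (auto simp del: upt_Suc)
    then show ?case
      using Suc by (auto simp: result_for_each R_def split_def le_Suc_eq simp del: upt_Suc)
  qed
  from this[of m "((\<lambda>_. undefined), (\<lambda>_. undefined), (\<lambda>_. undefined), (\<lambda>_. undefined))"]
  have R: "R m (result (sort_schools m t f g))"
    unfolding sort_schools_def timed_simps(5) result_insertion_sort using len by simp
  obtain p ts fs gs where res: "result (sort_schools m t f g) = (p, ts, fs, gs)"
    by (metis prod_cases4)
  have p: "p j = ?order ! (j - 1)"
    if "j \<in> {1..m}" for j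
    using R that by (auto simp: res R_def)
  have eq: "\<forall>j\<in>{1..m}. ts j = t (p j) \<and> fs j = f (p j) \<and> gs j = g (p j)"
    using R by (auto simp: res R_def)
  have "bij_betw (\<lambda>i. ?order ! i) {..<m} (set ?order)"
    by (rule bij_betw_nth) (auto simp: len)
  moreover have "bij_betw (\<lambda>j. j - 1) {1..m} {..<m}"
    by (rule bij_betwI[where g = Suc]) auto
  ultimately have "bij_betw ((\<lambda>i. ?order ! i) \<circ> (\<lambda>j. j - 1)) {1..m} (set ?order)"
    by (rule bij_betw_trans[rotated])
  moreover have "set ?order = {1..m}" by auto
  ultimately have bij: "bij_betw p {1..m} {1..m}"
    using p by (subst bij_betw_cong[of _ _ "(\<lambda>i. ?order ! i) \<circ> (\<lambda>j. j - 1)"]) auto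
  have "ts i \<le> ts j" if "1 \<le> i" "i \<le> j" "j \<le> m" for i j
  proof -
    have "map t ?order ! (i - 1) \<le> map t ?order ! (j - 1)"
      by (rule sorted_nth_mono) (use that in \<open>auto simp del: upt_Suc\<close>)
    then show ?thesis
      using that p eq len by auto
  qed
  then have "mono_on {1..m} ts" by (intro mono_onI) auto
  from that[OF res bij eq this] show thesis .
qed


section \<open>The dynamic program\<close>

text \<open>
  The grid point \<open>v = k \<cdot> 10\<^bsup>-P\<^esup>\<close> is represented by the integer \<open>k\<close>, with \<open>S = 10\<^bsup>P\<^esup>\<close> and
  \<open>\<delta> = 10\<^bsup>-P\<^esup>\<close>.  Of the valuation only its recursion along the sorted order is used, so that
  \<open>V\<close> can be the valuation of the portfolio renamed to the original indices.
\<close>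

locale sorted_schools =
  fixes m :: nat and t f g :: "nat \<Rightarrow> real" and V :: "nat set \<Rightarrow> real" and S \<delta> :: real
  assumes S_pos: "0 < S" and S_\<delta>: "S * \<delta> = 1"
    and data: "j \<in> {1..m} \<Longrightarrow> 0 < t j \<and> 0 < f j \<and> f j \<le> 1 \<and> 0 < g j"
    and sorted: "1 \<le> i \<Longrightarrow> i \<le> j \<Longrightarrow> j \<le> m \<Longrightarrow> t i \<le> t j"
    and V_empty: "V {} = 0"
    and V_insert: "j \<in> {1..m} \<Longrightarrow> Y \<subseteq> {1..<j} \<Longrightarrow> V (insert j Y) = f j * t j + (1 - f j) * V Y"
begin

lemma \<delta>_pos: "0 < \<delta>"
  using S_pos S_\<delta> by (metis zero_less_mult_pos zero_less_one)

lemma portfolio_induct [consumes 1, case_names empty insert]: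
  assumes "Y \<subseteq> {1..m}" "P {}"
    and "\<And>j Y. j \<in> {1..m} \<Longrightarrow> Y \<subseteq> {1..<j} \<Longrightarrow> Y \<subseteq> {1..m} \<Longrightarrow> P Y \<Longrightarrow> P (insert j Y)"
  shows "P Y"
proof -
  have "finite Y" using assms(1) finite_subset by blast
  then show ?thesis using assms(1)
  proof (induction Y rule: finite_linorder_max_induct)
    case (insert j Y)
    then show ?case by (intro assms(3)) auto
  qed (rule assms(2))
qed

lemma V_nonneg: "Y \<subseteq> {1..m} \<Longrightarrow> 0 \<le> V Y"
proof (induction rule: portfolio_induct)
  case (insert j Y)
  then show ?case using data[of j] by (simp add: V_insert)
qed (simp add: V_empty)

lemma V_le_sum: "Y \<subseteq> {1..m} \<Longrightarrow> V Y \<le> (\<Sum>j\<in>Y. f j * t j)"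
proof (induction rule: portfolio_induct)
  case (insert j Y)
  have "finite Y" "j \<notin> Y" using insert.hyps finite_subset by auto
  moreover have "(1 - f j) * V Y \<le> 1 * V Y"
    using insert.hyps data[of j] V_nonneg[of Y] by (intro mult_right_mono) auto
  ultimately show ?case using insert by (simp add: V_insert)
qed (simp add: V_empty)

lemma V_le: "Y \<subseteq> {1..m} \<Longrightarrow> 0 \<le> b \<Longrightarrow> (\<And>j. j \<in> Y \<Longrightarrow> t j \<le> b) \<Longrightarrow> V Y \<le> b"
proof (induction rule: portfolio_induct)
  case (insert j Y)
  have "f j * t j + (1 - f j) * V Y \<le> f j * b + (1 - f j) * b"
    using insert data[of j] by (intro add_mono mult_left_mono) auto
  then show ?case using insert.hyps by (simp add: V_insert algebra_simps)
qed (simp add: V_empty)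

text \<open>The index of \<open>v - \<Delta>\<^sub>j(v)\<close>; when \<open>f j = 1\<close>, the index \<open>0\<close> replaces the value \<open>-\<infinity>\<close>.\<close>

definition drop_index :: "nat \<Rightarrow> int \<Rightarrow> int" where
  "drop_index j k =
    (if f j < 1 then k - \<lfloor>S * (f j / (1 - f j) * (t j - of_int k * \<delta>))\<rfloor> else 0)"

primrec tab :: "nat \<Rightarrow> int \<Rightarrow> ereal" where
  "tab 0 k = (if k \<le> 0 then 0 else \<infinity>)"
| "tab (Suc j) k = (if k \<le> 0 then 0 else if t (Suc j) < of_int k * \<delta> then \<infinity>
     else min (tab j k) (ereal (g (Suc j)) + tab j (drop_index (Suc j) k)))"

lemma tab_nonpos: "k \<le> 0 \<Longrightarrow> tab j k = 0"
  by (cases j) auto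

lemma drop_index_le: "0 \<le> k \<Longrightarrow> j \<in> {1..m} \<Longrightarrow> of_int k * \<delta> \<le> t j \<Longrightarrow> drop_index j k \<le> k"
  using data[of j] S_pos by (auto simp: drop_index_def)

lemma
  assumes "f j < 1"
  shows drop_index_lower: "of_int k * \<delta> \<le> f j * t j + (1 - f j) * (of_int (drop_index j k) * \<delta>)"
    and drop_index_upper:
      "f j * t j + (1 - f j) * (of_int (drop_index j k) * \<delta>) \<le> of_int k * \<delta> + (1 - f j) * \<delta>"
proof -
  define v where "v = of_int k * \<delta>"
  define y where "y = f j / (1 - f j) * (t j - v)"
  have d: "of_int (drop_index j k) * \<delta> = v - of_int \<lfloor>S * y\<rfloor> * \<delta>"
    using assms by (simp add: drop_index_def v_def y_def algebra_simps)
  have y: "S * y * \<delta> = y"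
    using S_\<delta> by (simp add: ac_simps)
  have cancel: "(1 - f j) * y = f j * (t j - v)"
    using assms by (simp add: y_def)
  have "of_int \<lfloor>S * y\<rfloor> * \<delta> \<le> S * y * \<delta>" "S * y * \<delta> \<le> (of_int \<lfloor>S * y\<rfloor> + 1) * \<delta>"
    using \<delta>_pos by (intro mult_right_mono; linarith)+
  then have "v - y \<le> of_int (drop_index j k) * \<delta>" "of_int (drop_index j k) * \<delta> \<le> v - y + \<delta>"
    unfolding d y by (simp_all add: algebra_simps)
  then have "(1 - f j) * (v - y) \<le> (1 - f j) * (of_int (drop_index j k) * \<delta>)"
    "(1 - f j) * (of_int (drop_index j k) * \<delta>) \<le> (1 - f j) * (v - y + \<delta>)"
    using assms by (intro mult_left_mono; simp)+
  with cancel show "of_int k * \<delta> \<le> f j * t j + (1 - f j) * (of_int (drop_index j k) * \<delta>)"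
    "f j * t j + (1 - f j) * (of_int (drop_index j k) * \<delta>) \<le> of_int k * \<delta> + (1 - f j) * \<delta>"
    unfolding v_def[symmetric] by (simp_all add: algebra_simps)
qed

text \<open>The slack of one \<open>\<delta>\<close> per school absorbs the rounding of \<open>\<Delta>\<close>.\<close>

lemma tab_le_cost:
  assumes "j \<le> m" "Y \<subseteq> {1..j}" "of_int k * \<delta> \<le> V Y - real (card Y) * \<delta>"
  shows "tab j k \<le> ereal (\<Sum>i\<in>Y. g i)"
  using assms
proof (induction j arbitrary: Y k)
  case 0
  then have "of_int k * \<delta> \<le> 0" by (simp add: V_empty)
  then have "k \<le> 0" using \<delta>_pos by (simp add: mult_le_0_iff)
  then show ?case using 0 by simp
next
  case (Suc j)
  have fin: "finite Y" using Suc.prems(2) finite_subset by blast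
  have j: "Suc j \<in> {1..m}" using Suc.prems(1) by simp
  have Ym: "Y \<subseteq> {1..m}" using Suc.prems by fastforce
  have "V Y \<le> t (Suc j)"
    using Suc.prems Ym data[OF j] by (intro V_le) (auto intro!: sorted)
  moreover have "0 \<le> real (card Y) * \<delta>" using \<delta>_pos by simp
  ultimately have top: "of_int k * \<delta> \<le> t (Suc j)" using Suc.prems(3) by linarith
  have nonneg: "0 \<le> (\<Sum>i\<in>Y. g i)"
    using Ym data by (intro sum_nonneg) force
  show ?case
  proof (cases "k \<le> 0")
    case True
    then show ?thesis using nonneg by simp
  next
    case False
    show ?thesis
    proof (cases "Suc j \<in> Y")
      case notin: False
      then have "Y \<subseteq> {1..j}" using Suc.prems(2) by (auto simp: le_Suc_eq)
      then have "tab j k \<le> ereal (\<Sum>i\<in>Y. g i)"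
        using Suc.prems by (intro Suc.IH) auto
      then show ?thesis using False top by (auto simp: min_le_iff_disj)
    next
      case True
      define Y' where "Y' = Y - {Suc j}"
      have Y: "Y = insert (Suc j) Y'" "Suc j \<notin> Y'" "finite Y'"
        using True fin by (auto simp: Y'_def)
      have Y': "Y' \<subseteq> {1..j}" using Suc.prems(2) by (auto simp: Y'_def le_Suc_eq)
      then have V: "V Y = f (Suc j) * t (Suc j) + (1 - f (Suc j)) * V Y'"
        unfolding Y(1) using j by (intro V_insert) auto
      have card: "real (card Y) = real (card Y') + 1" using Y by simp
      have "tab j (drop_index (Suc j) k) \<le> ereal (\<Sum>i\<in>Y'. g i)"
      proof (cases "f (Suc j) < 1")
        case lt: True
        define c where "c = real (card Y') * \<delta>"
        have "(1 - f (Suc j)) * c + (1 - f (Suc j)) * \<delta> \<le> 1 * c + 1 * \<delta>"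
          using data[OF j] \<delta>_pos by (intro add_mono mult_right_mono) (auto simp: c_def)
        moreover have "of_int k * \<delta> \<le> V Y - (c + \<delta>)"
          using Suc.prems(3) unfolding card c_def by (simp add: algebra_simps)
        ultimately have "(1 - f (Suc j)) * (of_int (drop_index (Suc j) k) * \<delta>)
            \<le> (1 - f (Suc j)) * (V Y' - c)"
          using drop_index_upper[OF lt, of k] unfolding V
          by (simp only: right_diff_distrib)
        then have "of_int (drop_index (Suc j) k) * \<delta> \<le> V Y' - real (card Y') * \<delta>"
          using lt by (simp add: c_def)
        then show ?thesis using Suc.prems Y' by (intro Suc.IH) auto
      next
        case False
        have "0 \<le> (\<Sum>i\<in>Y'. g i)"
          using Ym data Y(1) by (intro sum_nonneg) force
        then show ?thesis using False by (simp add: drop_index_def tab_nonpos)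
      qed
      then have "ereal (g (Suc j)) + tab j (drop_index (Suc j) k) \<le> ereal (\<Sum>i\<in>Y. g i)"
        using Y add_left_mono[of _ "ereal (\<Sum>i\<in>Y'. g i)" "ereal (g (Suc j))"] by simp
      then show ?thesis using False top by (auto simp: min_le_iff_disj)
    qed
  qed
qed

definition represents :: "ereal \<Rightarrow> int \<Rightarrow> bool" where
  "represents v k \<longleftrightarrow> v = ereal (of_int k * \<delta>) \<or> v = -\<infinity> \<and> k \<le> 0"

lemma represents_nonpos_iff: "represents v k \<Longrightarrow> v \<le> 0 \<longleftrightarrow> k \<le> 0"
  using \<delta>_pos by (auto simp: represents_def mult_le_0_iff)

lemma floor_grid: "\<lfloor>S * (of_int k * \<delta>)\<rfloor> = k"
proof -
  have "S * (of_int k * \<delta>) = of_int k"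
    using S_\<delta> by (metis mult.left_commute mult.right_neutral)
  then show ?thesis by (simp only: floor_of_int)
qed

lemma result_lookup:
  assumes "represents v k" "0 < k \<Longrightarrow> G (j, nat k) = tab j k"
  shows "result (lookup S G j v) = tab j k"
proof (cases "k \<le> 0")
  case True
  then show ?thesis
    using represents_nonpos_iff[OF assms(1)] by (simp add: lookup_def tab_nonpos)
next
  case False
  then have "v = ereal (of_int k * \<delta>)" using assms(1) by (auto simp: represents_def)
  then show ?thesis
    using represents_nonpos_iff[OF assms(1)] False assms(2) by (simp add: lookup_def floor_grid)
qed

lemma represents_shifted:
  "represents (result (shifted S \<delta> (f j) (t j) (ereal (of_int k * \<delta>)))) (drop_index j k)"
  by (simp add: shifted_def round_down_def represents_def drop_index_def algebra_simps)

lemma result_entry: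
  assumes j: "j \<le> m" and k: "k \<le> N" and G: "\<And>i k. i < j \<Longrightarrow> k \<le> N \<Longrightarrow> G (i, k) = tab i (int k)"
  shows "result (entry t f g S \<delta> G j (real k * \<delta>)) = tab j (int k)"
proof (cases "k = 0 \<or> j = 0 \<or> t j < real k * \<delta>")
  case True
  then show ?thesis using \<delta>_pos
    by (cases j) (auto simp: entry_def mult_le_0_iff tab_nonpos)
next
  case False
  then obtain i where i: "j = Suc i" by (cases j) auto
  let ?w = "result (shifted S \<delta> (f j) (t j) (ereal (real k * \<delta>)))"
  have w: "represents ?w (drop_index j (int k))"
    using represents_shifted[of j "int k"] by simp
  have le: "drop_index j (int k) \<le> int k"
    using False j by (intro drop_index_le) auto
  have "result (lookup S G i (ereal (real k * \<delta>))) = tab i (int k)"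
    by (rule result_lookup) (use k i in \<open>auto simp: represents_def intro!: G\<close>)
  moreover have "result (lookup S G i ?w) = tab i (drop_index j (int k))"
  proof (rule result_lookup[OF w])
    assume "0 < drop_index j (int k)"
    then show "G (i, nat (drop_index j (int k))) = tab i (drop_index j (int k))"
      using G[of i "nat (drop_index j (int k))"] le k i by simp
  qed
  ultimately show ?thesis
    using False i \<delta>_pos by (simp add: entry_def mult_le_0_iff)
qed

lemma result_fill_table:
  assumes "j \<le> m" "k \<le> N"
  shows "result (fill_table m t f g S \<delta> N) (j, k) = tab j (int k)"
proof -
  define filled :: "nat \<Rightarrow> (nat \<times> nat \<Rightarrow> ereal) \<Rightarrow> bool"
    where "filled = (\<lambda>j G. \<forall>i<j. \<forall>k\<le>N. G (i, k) = tab i (int k))"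
  let ?row = "\<lambda>j k G. bind_timed (tick (real k * \<delta>))
      (\<lambda>v. bind_timed (entry t f g S \<delta> G j v) (\<lambda>x. put G (j, k) x))"
  have row: "filled (Suc j) (result (for_each [0..<N + 1] (?row j) G))"
    if G: "filled j G" and j: "j \<le> m" for j G
  proof -
    let ?I = "\<lambda>n G. filled j G \<and> (\<forall>k<n. G (j, k) = tab j (int k))"
    have "?I (N + 1) (result (for_each [0..<N + 1] (?row j) G))"
    proof (rule result_for_each_upt[where I = ?I])
      fix n G assume "n < N + 1" "?I n G"
      then show "?I (Suc n) (result (?row j n G))"
        using j result_entry[of j n N G] by (auto simp: filled_def less_Suc_eq)
    qed (use G in auto)
    then have "result (for_each [0..<N + 1] (?row j) G) (i, k) = tab i (int k)"
      if "i < Suc j" "k \<le> N" for i k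
      using that by (cases "i = j") (simp_all add: filled_def del: upt_Suc)
    then show ?thesis by (simp add: filled_def del: upt_Suc)
  qed
  have "filled (m + 1) (result (fill_table m t f g S \<delta> N))"
    unfolding fill_table_def
    by (rule result_for_each_upt[where I = filled])
       (use row in \<open>auto simp: filled_def simp del: upt_Suc\<close>)
  then show ?thesis using assms by (simp add: filled_def)
qed

lemma result_best_value:
  assumes H: "0 \<le> H" and G: "\<And>k. k \<le> N \<Longrightarrow> G (m, k) = tab m (int k)"
  obtains k where "k \<le> N" "result (best_value m H S \<delta> N G) = real k * \<delta>" "tab m (int k) \<le> ereal H"
    "\<And>l. l \<le> N \<Longrightarrow> tab m (int l) \<le> ereal H \<Longrightarrow> l \<le> k"
proof -
  let ?I = "\<lambda>n v. \<exists>k\<le>N. v = real k * \<delta> \<and> tab m (int k) \<le> ereal H \<and>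
    (\<forall>l<n. tab m (int l) \<le> ereal H \<longrightarrow> l \<le> k)"
  have "?I (N + 1) (result (best_value m H S \<delta> N G))"
    unfolding best_value_def
  proof (rule result_for_each_upt[where I = ?I])
    show "?I 0 0" using H by (intro exI[of _ 0]) (simp add: tab_nonpos)
  next
    fix n v assume n: "n < N + 1" and I: "?I n v"
    have lookup: "result (lookup S G m (ereal (real n * \<delta>))) = tab m (int n)"
      by (rule result_lookup) (use n in \<open>auto simp: represents_def intro!: G\<close>)
    from I obtain k where k: "k \<le> N" "v = real k * \<delta>" "tab m (int k) \<le> ereal H"
      "\<forall>l<n. tab m (int l) \<le> ereal H \<longrightarrow> l \<le> k" by blast
    have max: "max (real k * \<delta>) (real n * \<delta>) = real (max k n) * \<delta>"
      using \<delta>_pos by (auto simp: max_def)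
    show "?I (Suc n) (result (bind_timed (tick (real n * \<delta>)) (\<lambda>w. bind_timed (lookup S G m (ereal w))
      (\<lambda>x. bind_timed (tick (x \<le> ereal H)) (\<lambda>b. if b then tick (max v w) else ret v)))))"
    proof (cases "tab m (int n) \<le> ereal H")
      case True
      show ?thesis
        using True k n lookup max by (intro exI[of _ "max k n"]) (auto simp: less_Suc_eq max_def)
    next
      case False
      then show ?thesis
        using k lookup by (intro exI[of _ k]) (auto simp: less_Suc_eq)
    qed
  qed simp
  then show thesis using that by (auto simp: less_Suc_eq_le)
qed

lemma result_backtrack:
  assumes G: "\<And>j k. j \<le> m \<Longrightarrow> k \<le> N \<Longrightarrow> G (j, k) = tab j (int k)"
    and k: "k \<le> N" "tab m (int k) < \<infinity>"
  obtains Y where "Y \<subseteq> {1..m}" "result (backtrack m p t f S \<delta> G (real k * \<delta>)) = p ` Y"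
    "ereal (\<Sum>j\<in>Y. g j) = tab m (int k)" "real k * \<delta> \<le> V Y"
proof -
  define body where "body = (\<lambda>j (X, v).
          bind_timed (lookup S G j v) (\<lambda>x. bind_timed (tick (x < \<infinity>)) (\<lambda>b.
          if b then bind_timed (tick (j - 1)) (\<lambda>i. bind_timed (lookup S G i v) (\<lambda>y.
            bind_timed (tick (x < y)) (\<lambda>c.
            if c then bind_timed (get p j) (\<lambda>s. bind_timed (tick (insert s X)) (\<lambda>X.
              bind_timed (get f j) (\<lambda>fj. bind_timed (get t j) (\<lambda>tj.
              bind_timed (shifted S \<delta> fj tj v) (\<lambda>v. ret (X, v))))))
            else ret (X, v))))
          else ret (X, v))))"
  have "\<exists>Y. Y \<subseteq> {1..j} \<and> fst (result (for_each (rev [1..<j + 1]) body (X, v))) = X \<union> p ` Y \<and>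
      ereal (\<Sum>j\<in>Y. g j) = tab j k \<and> of_int k * \<delta> \<le> V Y"
    if "j \<le> m" "represents v k" "k \<le> int N" "tab j k < \<infinity>" for j k X v
    using that
  proof (induction j arbitrary: k X v)
    case 0
    then have "k \<le> 0" by (auto split: if_splits)
    then show ?case
      using \<delta>_pos by (auto simp: V_empty mult_le_0_iff)
  next
    case (Suc j)
    have lookup: "result (lookup S G i v) = tab i k" if "i \<le> m" for i
      by (rule result_lookup) (use Suc.prems that G[of i "nat k"] in auto)
    have unroll: "result (for_each (rev [1..<Suc j + 1]) body s) =
        result (for_each (rev [1..<j + 1]) body (result (body (Suc j) s)))" for s
      by simp
    have j: "Suc j \<in> {1..m}" using Suc.prems(1) by simp
    show ?case
    proof (cases "tab (Suc j) k < tab j k")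
      case True
      then have k: "0 < k" "of_int k * \<delta> \<le> t (Suc j)"
          "tab (Suc j) k = ereal (g (Suc j)) + tab j (drop_index (Suc j) k)"
        using Suc.prems(4) by (auto simp: tab_nonpos min_def split: if_splits)
      define d where "d = drop_index (Suc j) k"
      have v: "v = ereal (of_int k * \<delta>)"
        using Suc.prems(2) k by (auto simp: represents_def)
      let ?w = "result (shifted S \<delta> (f (Suc j)) (t (Suc j)) v)"
      have step: "result (body (Suc j) (X, v)) = (insert (p (Suc j)) X, ?w)"
        using True Suc.prems by (simp add: body_def lookup del: tab.simps)
      have "represents ?w d"
        unfolding d_def v by (rule represents_shifted)
      moreover have "d \<le> int N"
        using drop_index_le[of k "Suc j"] k j Suc.prems(3) by (simp add: d_def)
      moreover have "tab j d < \<infinity>"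
        using k(3) Suc.prems(4) by (auto simp: d_def)
      ultimately obtain Y where Y: "Y \<subseteq> {1..j}"
        "fst (result (for_each (rev [1..<j + 1]) body (insert (p (Suc j)) X, ?w))) =
          insert (p (Suc j)) X \<union> p ` Y"
        "ereal (\<Sum>j\<in>Y. g j) = tab j d" "of_int d * \<delta> \<le> V Y"
        using Suc.IH[of ?w d "insert (p (Suc j)) X"] Suc.prems(1) by auto
      have fin: "finite Y" "Suc j \<notin> Y" using Y(1) finite_subset by auto
      have V: "V (insert (Suc j) Y) = f (Suc j) * t (Suc j) + (1 - f (Suc j)) * V Y"
        using Y(1) j by (intro V_insert) auto
      have "of_int k * \<delta> \<le> V (insert (Suc j) Y)"
      proof (cases "f (Suc j) < 1")
        case True
        have "(1 - f (Suc j)) * (of_int d * \<delta>) \<le> (1 - f (Suc j)) * V Y"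
          using True Y(4) by (intro mult_left_mono) auto
        then show ?thesis
          using drop_index_lower[OF True, of k] unfolding V d_def by linarith
      next
        case False
        then have "f (Suc j) = 1" using data[OF j] by simp
        then show ?thesis using k V by simp
      qed
      moreover have "ereal (\<Sum>j\<in>insert (Suc j) Y. g j) = tab (Suc j) k"
        unfolding k(3) d_def[symmetric] Y(3)[symmetric] using fin by simp
      moreover have "fst (result (for_each (rev [1..<Suc j + 1]) body (X, v))) = X \<union> p ` insert (Suc j) Y"
        unfolding unroll step Y(2) by auto
      ultimately show ?thesis
        using Y(1) by (intro exI[of _ "insert (Suc j) Y"]) auto
    next
      case False
      then have eq: "tab j k = tab (Suc j) k"
        using Suc.prems(4) by (auto simp: tab_nonpos min_def split: if_splits)
      have step: "result (body (Suc j) (X, v)) = (X, v)"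
        using False Suc.prems by (simp add: body_def lookup del: tab.simps)
      obtain Y where "Y \<subseteq> {1..j}"
        "fst (result (for_each (rev [1..<j + 1]) body (X, v))) = X \<union> p ` Y"
        "ereal (\<Sum>j\<in>Y. g j) = tab j k" "of_int k * \<delta> \<le> V Y"
        using Suc.IH[of v k X] Suc.prems eq by auto
      then show ?thesis
        unfolding unroll step eq by (intro exI[of _ Y]) auto
    qed
  qed
  from this[of m "ereal (real k * \<delta>)" "int k" "{}"] k obtain Y where
    "Y \<subseteq> {1..m}" "fst (result (for_each (rev [1..<m + 1]) body ({}, ereal (real k * \<delta>)))) = p ` Y"
    "ereal (\<Sum>j\<in>Y. g j) = tab m (int k)" "real k * \<delta> \<le> V Y"
    by (auto simp: represents_def)
  moreover have "result (backtrack m p t f S \<delta> G (real k * \<delta>)) =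
      fst (result (for_each (rev [1..<m + 1]) body ({}, ereal (real k * \<delta>))))"
    unfolding backtrack_def body_def by (simp add: split_def)
  ultimately show thesis using that by simp
qed

end


section \<open>The approximation guarantee\<close>

lemma precision_scale_bounds:
  assumes "0 < m" "0 < \<epsilon>" "0 < U"
  defines "S \<equiv> result (precision_scale m \<epsilon> U)"
  shows "real m ^ 2 / (\<epsilon> * U) \<le> S" "S \<le> 10 * (real m ^ 2 / (\<epsilon> * U))"
proof -
  define a where "a = real m ^ 2 / (\<epsilon> * U)"
  have a: "0 < a" using assms(1-3) by (simp add: a_def)
  have S: "S = 10 powr \<lceil>log 10 a\<rceil>"
    by (simp add: S_def precision_scale_def a_def power2_eq_square powr_real_of_int')
  have "10 powr log 10 a \<le> S" "S \<le> 10 powr (log 10 a + 1)"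
    unfolding S by (simp_all add: powr_mono)
  then show "a \<le> S" "S \<le> 10 * a"
    using a by (simp_all add: powr_add)
qed

lemma ellis_instance_pos: "ellis_instance m t f g H \<Longrightarrow> 0 < m"
  by (cases m) (auto simp: ellis_instance_def)

lemma algorithm_F_approximates:
  assumes inst: "ellis_instance m t f g H" and \<epsilon>: "0 < \<epsilon>"
  shows "feasible m g H (result (algorithm_F m t f g H \<epsilon>))"
    and "valuation m t f (result (algorithm_F m t f g H \<epsilon>)) \<ge> (1 - \<epsilon>) * optimal_value m t f g H"
proof -
  have m: "0 < m" using inst by (rule ellis_instance_pos)
  have H: "0 < H" "H < (\<Sum>j\<in>{1..m}. g j)"
    and school: "\<And>j. j \<in> {1..m} \<Longrightarrow> 0 < t j \<and> 0 < f j \<and> f j \<le> 1 \<and> 0 < g j \<and> g j \<le> H"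
    using inst by (auto simp: ellis_instance_def)
  obtain p ts fs gs where sort: "result (sort_schools m t f g) = (p, ts, fs, gs)"
    and p: "bij_betw p {1..m} {1..m}"
    and eq: "\<forall>j\<in>{1..m}. ts j = t (p j) \<and> fs j = f (p j) \<and> gs j = g (p j)"
    and mono: "mono_on {1..m} ts"
    by (rule result_sort_schools)
  have perm: "ts j = t (p j) \<and> fs j = f (p j) \<and> gs j = g (p j)" if "j \<in> {1..m}" for j
    using eq that by blast
  have p_in: "p j \<in> {1..m}" if "j \<in> {1..m}" for j
    using p that by (rule bij_betw_apply)
  have p_inj: "inj_on p {1..m}" using p by (rule bij_betw_imp_inj_on)
  have sum_gs: "(\<Sum>j\<in>Y. gs j) = (\<Sum>i\<in>p ` Y. g i)" if "Y \<subseteq> {1..m}" for Y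
  proof -
    have "(\<Sum>i\<in>p ` Y. g i) = (\<Sum>j\<in>Y. g (p j))"
      using inj_on_subset[OF p_inj that] by (simp add: sum.reindex)
    also have "\<dots> = (\<Sum>j\<in>Y. gs j)"
      using that perm by (intro sum.cong) auto
    finally show ?thesis by simp
  qed
  define U where "U = (\<Sum>j\<in>{1..m}. fs j * ts j)"
  have U: "0 < U"
    unfolding U_def using m school p_in perm by (intro sum_pos) auto
  define S where "S = result (precision_scale m \<epsilon> U)"
  define \<delta> where "\<delta> = 1 / S"
  define N where "N = nat \<lfloor>S * U\<rfloor>"
  have S: "real m ^ 2 / (\<epsilon> * U) \<le> S"
    unfolding S_def using m \<epsilon> U by (rule precision_scale_bounds)
  have "0 < real m ^ 2 / (\<epsilon> * U)" using m \<epsilon> U by simp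
  with S have S_pos: "0 < S" by linarith
  define V where "V = (\<lambda>Y. valuation m t f (p ` Y))"
  interpret sorted_schools m ts fs gs V S \<delta>
  proof
    show "0 < S" "S * \<delta> = 1" using S_pos by (simp_all add: \<delta>_def)
    show "0 < ts j \<and> 0 < fs j \<and> fs j \<le> 1 \<and> 0 < gs j" if "j \<in> {1..m}" for j
      using perm[OF that] school[OF p_in[OF that]] by simp
    show "ts i \<le> ts j" if "1 \<le> i" "i \<le> j" "j \<le> m" for i j
      using that by (intro mono_onD[OF mono]) auto
    show "V {} = 0" by (simp add: V_def valuation_empty)
    show "V (insert j Y) = fs j * ts j + (1 - fs j) * V Y"
      if j: "j \<in> {1..m}" and Y: "Y \<subseteq> {1..<j}" for j Y
    proof -
      have Ym: "Y \<subseteq> {1..m}" using j Y by fastforce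
      have "t k \<le> t (p j)" if k: "k \<in> p ` Y" for k
      proof -
        obtain i where i: "i \<in> Y" "k = p i" using k by blast
        then have "i \<in> {1..m}" "i \<le> j" using Ym Y by auto
        with i j show ?thesis using mono_onD[OF mono, of i j] perm by metis
      qed
      moreover have "0 \<le> t k" if "k \<in> p ` Y" for k
        using that p_in Ym by (intro less_imp_le conjunct1[OF school]) auto
      moreover have "p j \<notin> p ` Y"
        using inj_on_image_mem_iff[OF p_inj j Ym] Y by auto
      ultimately show ?thesis
        using school[OF p_in[OF j]] perm[OF j] p_in Ym j
        unfolding V_def image_insert
        by (subst valuation_insert_top) auto
    qed
  qed
  define X where "X = result (algorithm_F m t f g H \<epsilon>)"
  define G where "G = result (fill_table m ts fs gs S \<delta> N)"
  have G: "G (j, k) = tab j (int k)" if "j \<le> m" "k \<le> N" for j k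
    unfolding G_def using that by (rule result_fill_table)
  obtain k where k: "k \<le> N" "result (best_value m H S \<delta> N G) = real k * \<delta>" "tab m (int k) \<le> ereal H"
    and k_max: "\<And>l. l \<le> N \<Longrightarrow> tab m (int l) \<le> ereal H \<Longrightarrow> l \<le> k"
    using result_best_value[where H = H and N = N and G = G] H(1) G by (metis less_imp_le order_refl)
  have "tab m (int k) < \<infinity>" using k(3) by (rule order.strict_trans1) simp
  then obtain Y where Y: "Y \<subseteq> {1..m}" "result (backtrack m p ts fs S \<delta> G (real k * \<delta>)) = p ` Y"
    "ereal (\<Sum>j\<in>Y. gs j) = tab m (int k)" "real k * \<delta> \<le> V Y"
    using result_backtrack[where G = G and N = N and k = k and p = p] G k(1) by metis
  have X: "X = p ` Y"
    unfolding X_def Y(2)[symmetric] k(2)[symmetric]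
    by (simp add: algorithm_F_def sort result_total_utility grid_size_def
        G_def N_def S_def U_def \<delta>_def)
  show "feasible m g H (result (algorithm_F m t f g H \<epsilon>))"
    unfolding X_def[symmetric] X feasible_def
    using Y(1,3) k(3) sum_gs p_in by (metis ereal_less_eq(3) image_subsetI subsetD)

  define OPT where "OPT = optimal_value m t f g H"
  have fin: "finite {X. feasible m g H X}"
    by (rule finite_subset[of _ "Pow {1..m}"]) (auto simp: feasible_def)
  have "OPT \<in> valuation m t f ` {X. feasible m g H X}"
    unfolding OPT_def optimal_value_def
    using H(1) by (intro Max_in finite_imageI fin) (auto simp: feasible_def intro!: exI[of _ "{}"])
  then obtain Xo where Xo: "feasible m g H Xo" "OPT = valuation m t f Xo" by auto
  define Yo where "Yo = {j \<in> {1..m}. p j \<in> Xo}"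
  have Yo: "Yo \<subseteq> {1..m}" by (auto simp: Yo_def)
  have "Xo \<subseteq> p ` {1..m}"
    using Xo(1) bij_betw_imp_surj_on[OF p] unfolding feasible_def by simp
  then have pYo: "p ` Yo = Xo"
    unfolding Yo_def by blast
  have OPT: "OPT = V Yo" by (simp add: V_def pYo Xo(2))
  have Yo_cost: "(\<Sum>j\<in>Yo. gs j) \<le> H"
    using Xo(1) by (simp add: sum_gs[OF Yo] pYo feasible_def)
  have "(\<Sum>j\<in>{1..m}. gs j) = (\<Sum>j\<in>{1..m}. g j)"
    using bij_betw_imp_surj_on[OF p] by (simp add: sum_gs)
  with Yo_cost H(2) have "Yo \<noteq> {1..m}" by auto
  then have "card Yo < m"
    using Yo psubset_card_mono[of "{1..m}" Yo] by auto
  then have card: "real (card Yo) + 1 \<le> real m" by simp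

  have single: "fs j * ts j \<le> OPT" if j: "j \<in> {1..m}" for j
  proof -
    have "V {j} = fs j * ts j" using V_insert[of j "{}"] j by (simp add: V_empty)
    moreover have "feasible m g H {p j}"
      using school[OF p_in[OF j]] p_in[OF j] by (simp add: feasible_def)
    then have "V {j} \<le> OPT"
      unfolding OPT_def optimal_value_def V_def using fin by (intro Max_ge) auto
    ultimately show ?thesis by simp
  qed
  have "U \<le> real m * OPT"
    unfolding U_def using sum_bounded_above[of "{1..m}" "\<lambda>j. fs j * ts j" OPT] single by simp
  then have "\<epsilon> * U \<le> \<epsilon> * (real m * OPT)" using \<epsilon> by simp
  moreover have "real m * real m * \<delta> \<le> \<epsilon> * U"
    using S S_pos \<epsilon> U by (simp add: \<delta>_def field_simps power2_eq_square)
  ultimately have "real m * (real m * \<delta>) \<le> real m * (\<epsilon> * OPT)"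
    by (simp add: mult_ac)
  then have loss: "real m * \<delta> \<le> \<epsilon> * OPT"
    using m by simp

  have "OPT \<le> U"
  proof -
    have "OPT \<le> (\<Sum>j\<in>Yo. fs j * ts j)" unfolding OPT using Yo by (rule V_le_sum)
    also have "\<dots> \<le> U"
      unfolding U_def using Yo data
      by (intro sum_mono2) (auto simp: less_imp_le)
    finally show ?thesis .
  qed
  define w where "w = OPT - real (card Yo) * \<delta>"
  define k\<^sub>0 where "k\<^sub>0 = \<lfloor>S * w\<rfloor>"
  have w: "S * w * \<delta> = w" using S_pos by (simp add: \<delta>_def)
  have "of_int k\<^sub>0 * \<delta> \<le> S * w * \<delta>" "S * w * \<delta> \<le> (of_int k\<^sub>0 + 1) * \<delta>"
    using \<delta>_pos unfolding k\<^sub>0_def by (intro mult_right_mono; linarith)+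
  then have k\<^sub>0: "of_int k\<^sub>0 * \<delta> \<le> w" "w \<le> of_int k\<^sub>0 * \<delta> + \<delta>"
    unfolding w by (simp_all add: distrib_right)
  have "k\<^sub>0 \<le> int k"
  proof (cases "k\<^sub>0 \<le> 0")
    case False
    have "0 \<le> real (card Yo) * \<delta>" using \<delta>_pos by simp
    with \<open>OPT \<le> U\<close> have "w \<le> U" unfolding w_def by linarith
    then have "S * w \<le> S * U" using S_pos by simp
    then have "nat k\<^sub>0 \<le> N" unfolding N_def k\<^sub>0_def by (intro nat_mono floor_mono)
    moreover have "tab m k\<^sub>0 \<le> ereal (\<Sum>j\<in>Yo. gs j)"
      using Yo k\<^sub>0(1) by (intro tab_le_cost) (auto simp: w_def OPT)
    then have "tab m k\<^sub>0 \<le> ereal H"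
      by (rule order.trans) (simp add: Yo_cost)
    then have "tab m (int (nat k\<^sub>0)) \<le> ereal H"
      using False by simp
    ultimately show ?thesis using k_max[of "nat k\<^sub>0"] False by simp
  qed simp
  then have "of_int k\<^sub>0 * \<delta> \<le> real k * \<delta>"
    using \<delta>_pos by (intro mult_right_mono) auto
  then have "OPT \<le> real k * \<delta> + (real (card Yo) + 1) * \<delta>"
    using k\<^sub>0(2) by (simp add: w_def algebra_simps)
  also have "\<dots> \<le> V Y + real m * \<delta>"
    using Y(4) card \<delta>_pos by (intro add_mono mult_right_mono) auto
  finally have "(1 - \<epsilon>) * OPT \<le> V Y"
    using loss by (simp add: algebra_simps)
  then show "valuation m t f (result (algorithm_F m t f g H \<epsilon>)) \<ge> (1 - \<epsilon>) * optimal_value m t f g H"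
    by (simp add: X_def[symmetric] X V_def OPT_def)
qed

lemma time_algorithm_F:
  assumes inst: "ellis_instance m t f g H" and \<epsilon>: "0 < \<epsilon>" "\<epsilon> < 1"
  shows "real (time (algorithm_F m t f g H \<epsilon>)) \<le> 1000 * (real m ^ 3 / \<epsilon>)"
proof -
  have m: "1 \<le> real m" using ellis_instance_pos[OF inst] by simp
  obtain p ts fs gs where sort: "result (sort_schools m t f g) = (p, ts, fs, gs)"
    and p: "bij_betw p {1..m} {1..m}"
    and perm: "\<forall>j\<in>{1..m}. ts j = t (p j) \<and> fs j = f (p j) \<and> gs j = g (p j)"
    by (rule result_sort_schools)
  define U where "U = (\<Sum>j\<in>{1..m}. fs j * ts j)"
  have U: "0 < U"
    unfolding U_def using m inst perm bij_betw_apply[OF p]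
    by (intro sum_pos) (auto simp: ellis_instance_def)
  define S where "S = result (precision_scale m \<epsilon> U)"
  define N where "N = nat \<lfloor>S * U\<rfloor>"
  define A where "A = real m ^ 3 / \<epsilon>"
  have S: "real m ^ 2 / (\<epsilon> * U) \<le> S" "S \<le> 10 * (real m ^ 2 / (\<epsilon> * U))"
    unfolding S_def using precision_scale_bounds[OF ellis_instance_pos[OF inst] \<epsilon>(1) U] .
  have "0 \<le> real m ^ 2 / (\<epsilon> * U)" using \<epsilon> U by simp
  then have "0 \<le> S * U" using S(1) U by simp
  then have "real N \<le> S * U" by (simp add: N_def)
  also have "\<dots> \<le> 10 * (real m ^ 2 / (\<epsilon> * U)) * U"
    using S(2) U by (intro mult_right_mono) auto
  also have "\<dots> = 10 * (real m ^ 2 / \<epsilon>)" using U by simp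
  finally have N: "real N \<le> 10 * (real m ^ 2 / \<epsilon>)" .
  have m2: "1 \<le> real m ^ 2" using m by simp
  have "real m ^ 2 * 1 \<le> real m ^ 2 * (1 / \<epsilon>)"
    using \<epsilon> m by (intro mult_left_mono) auto
  then have m2\<epsilon>: "real m ^ 2 \<le> real m ^ 2 / \<epsilon>" by simp
  have A: "A = real m * (real m ^ 2 / \<epsilon>)" by (simp add: A_def power3_eq_cube power2_eq_square)
  have "1 * (real m ^ 2 / \<epsilon>) \<le> A"
    unfolding A using m \<epsilon> by (intro mult_right_mono) auto
  then have m2A: "real m ^ 2 / \<epsilon> \<le> A" by simp
  have mm: "real m * 1 \<le> real m * real m" using m by (intro mult_left_mono) auto
  have sq: "real m * real m \<le> A" using m2\<epsilon> m2A unfolding power2_eq_square by (rule order.trans)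
  have N10: "9 * real N \<le> 90 * A" using N m2A by linarith
  have "real N + 1 \<le> 11 * (real m ^ 2 / \<epsilon>)"
    using N m2 m2\<epsilon> by linarith
  then have "(real m + 1) * (real N + 1) \<le> (2 * real m) * (11 * (real m ^ 2 / \<epsilon>))"
    using m by (intro mult_mono) auto
  then have table: "(real m + 1) * (real N + 1) \<le> 22 * A" by (simp add: A)
  have "time (algorithm_F m t f g H \<epsilon>) \<le>
      (m * (4 * m + 12) + 2) + (m * 6 + 1) + 6 + 1 + 2 +
      ((m + 1) * ((N + 1) * 34 + 3) + 1) + ((N + 1) * 9 + 1) + (m * 26 + 1)"
    unfolding algorithm_F_def timed_simps sort prod.case
      result_total_utility U_def[symmetric] S_def[symmetric]
    using time_sort_schools[of m t f g] time_total_utility[of m ts fs]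
      time_fill_table[of m ts fs gs S "1 / S" N]
      time_best_value[of m H S "1 / S" N "result (fill_table m ts fs gs S (1 / S) N)"]
      time_backtrack[of m p ts fs S "1 / S" "result (fill_table m ts fs gs S (1 / S) N)"
        "result (best_value m H S (1 / S) N (result (fill_table m ts fs gs S (1 / S) N)))"]
    by (simp add: precision_scale_def grid_size_def N_def)
  then have "real (time (algorithm_F m t f g H \<epsilon>)) \<le> real (
      (m * (4 * m + 12) + 2) + (m * 6 + 1) + 6 + 1 + 2 +
      ((m + 1) * ((N + 1) * 34 + 3) + 1) + ((N + 1) * 9 + 1) + (m * 26 + 1))"
    by (rule of_nat_mono)
  also have "\<dots> = 4 * (real m * real m) + 47 * real m + 9 * real N + 27 +
      34 * ((real m + 1) * (real N + 1))"
    by (simp add: algebra_simps)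
  also have "\<dots> \<le> 1000 * A"
    using table N10 sq mm m by linarith
  finally show ?thesis by (simp add: A_def)
qed

theorem theorem9:
  shows "\<exists>C::real. C > 0 \<and>
    (\<forall>(m::nat) (t::nat \<Rightarrow> real) (f::nat \<Rightarrow> real) (g::nat \<Rightarrow> real) (H::real) (\<epsilon>::real).
       ellis_instance m t f g H \<and> 0 < \<epsilon> \<and> \<epsilon> < 1 \<longrightarrow>
         feasible m g H (result (algorithm_F m t f g H \<epsilon>)) \<and>
         valuation m t f (result (algorithm_F m t f g H \<epsilon>))
           \<ge> (1 - \<epsilon>) * optimal_value m t f g H \<and>
         real (time (algorithm_F m t f g H \<epsilon>)) \<le> C * (real m ^ 3 / \<epsilon>))"
  by (rule exI[of _ 1000]) (use algorithm_F_approximates time_algorithm_F in auto)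

end
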